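(* Let $T$ be an in-quadrangular tournament and let $v\in V(T)$. Let $W$ be the subtournament of $T$ induced on the vertex set $I(v)$. Then $W$ contains no vertex of in-degree $1$ (in-degree computed in $W$).
   Context: A tournament $T$ is a loopless digraph in which for each pair of distinct vertices exactly one of $(u,v)$, $(v,u)$ is an arc; $u\rightarrow v$ means $(u,v)$ is an arc. $I(v)=\{u:u\rightarrow v\}$. A digraph is in-quadrangular if $|I(u)\cap I(v)|\neq 1$ for all distinct vertices $u,v$. *)

theory Defs
  imports "Graph_Theory.Digraph_Component"
begin

(* Finiteness is not part of the definition. Arc sets of digraphs are sets of ordered
   pairs, hence no parallel arcs. *)
locale tournament = loopfree_digraph + nomulti_digraph +
  assumes exactly_one_arc:
    "\<lbrakk>u \<in> verts G; v \<in> verts G; u \<noteq> v\<rbrakk> \<Longrightarrow> (u \<rightarrow>\<^bsub>G\<^esub> v) \<noteq> (v \<rightarrow>\<^bsub>G\<^esub> u)"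

definition in_nbhd :: "('a, 'b) pre_digraph \<Rightarrow> 'a \<Rightarrow> 'a set" where
  "in_nbhd G v = {u \<in> verts G. u \<rightarrow>\<^bsub>G\<^esub> v}"

(* card is 0 on infinite sets, so "card A = 1" means exactly that A is a singleton,
   also when in-neighbourhoods are infinite. *)
definition in_quadrangular :: "('a, 'b) pre_digraph \<Rightarrow> bool" where
  "in_quadrangular G \<longleftrightarrow>
    (\<forall>u \<in> verts G. \<forall>v \<in> verts G. u \<noteq> v \<longrightarrow> card (in_nbhd G u \<inter> in_nbhd G v) \<noteq> 1)"

end

theory Submission
  imports Defs
begin

text \<open>For \<open>w\<close> in \<open>I(v)\<close>, the in-neighbours of \<open>w\<close>
  within the subdigraph induced on \<open>I(v)\<close> are exactly the common in-neighbours of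
  \<open>w\<close> and \<open>v\<close>. Counting arcs into \<open>w\<close> by their tails thus
  turns an in-degree of 1 into \<open>I(w)\<close> and \<open>I(v)\<close> meeting in a single
  vertex, which in-quadrangularity forbids.\<close>

lemma (in nomulti_digraph) in_degree_induce_in_nbhd:
  assumes "w \<in> in_nbhd G v"
  shows "in_degree (G \<restriction> in_nbhd G v) w = card (in_nbhd G w \<inter> in_nbhd G v)"
proof -
  let ?A = "in_arcs (G \<restriction> in_nbhd G v) w"
  \<comment> \<open>All arcs in \<open>?A\<close> have head \<open>w\<close>, so two with a common
    tail would be parallel.\<close>
  have "inj_on (tail G) ?A"
    by (auto intro!: inj_onI no_multi_arcs simp: arc_to_ends_def)
  moreover have "tail G ` ?A = in_nbhd G w \<inter> in_nbhd G v"
  proof (intro equalityI subsetI)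
    fix u assume "u \<in> tail G ` ?A"
    then show "u \<in> in_nbhd G w \<inter> in_nbhd G v"
      by (auto simp: in_nbhd_def intro: in_arcs_imp_in_arcs_ends)
  next
    fix u assume u: "u \<in> in_nbhd G w \<inter> in_nbhd G v"
    then obtain e where "e \<in> arcs G" "tail G e = u" "head G e = w"
      by (auto simp: in_nbhd_def arcs_ends_conv)
    \<comment> \<open>The arc survives the restriction because both ends lie in \<open>I(v)\<close>:
      its tail by \<open>u\<close>, its head \<open>w\<close> by assumption.\<close>
    with u assms have "e \<in> ?A" by auto
    with \<open>tail G e = u\<close> show "u \<in> tail G ` ?A" by blast
  qed
  ultimately show ?thesis
    by (metis card_image in_degree_def)
qed

theorem theorem10:
  fixes T W :: "('a, 'b) pre_digraph" and v :: 'a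
  assumes "tournament T"
    and "in_quadrangular T"
    and "v \<in> verts T"
    and "W = T \<restriction> in_nbhd T v"
  shows "\<not> (\<exists>w \<in> verts W. in_degree W w = 1)"
proof
  interpret tournament T by fact
  assume "\<exists>w \<in> verts W. in_degree W w = 1"
  then obtain w where w: "w \<in> in_nbhd T v" and deg: "in_degree W w = 1"
    using assms(4) by auto
  have "card (in_nbhd T w \<inter> in_nbhd T v) = 1"
    using deg in_degree_induce_in_nbhd[OF w] assms(4) by simp
  \<comment> \<open>If \<open>w = v\<close>, the arc from \<open>w\<close> to \<open>v\<close> would
    be a loop.\<close>
  moreover have "w \<in> verts T" "w \<noteq> v"
    using w adj_not_same by (auto simp: in_nbhd_def)
  ultimately show False
    using assms(2,3) unfolding in_quadrangular_def by blast
qed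

end
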